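(* Let $X$ be a closed preimage of $\omega_1$, with closed map $\pi:X\to\omega_1$, and let $S\subset\omega_1$ be stationary. (a) If $|\pi^{-1}(\{\alpha\})|<\omega$ for every $\alpha\in S$, then $X$ contains a direction. (b) Suppose that $2^{\omega}\ge\lambda>\omega_1$ with $\lambda$ a regular cardinal, and that $|\pi^{-1}(\{\alpha\})|<\lambda$ for every $\alpha\in S$. Then $X$ contains a direction.
   Context: All spaces are Hausdorff and all functions are continuous unless otherwise specified. A closed preimage of $\omega_1$ is a space $X$ for which there is a (continuous) closed map $\pi:X\to\omega_1$ with $\pi^{-1}(\{\alpha\})\ne\varnothing$ for all $\alpha$; here $X$ is regarded as a Type I space with $X_\alpha=\pi^{-1}([0,\alpha))$. A space $X$ is Type I if $X=\bigcup_{\alpha<\omega_1}X_\alpha$ with each $X_\alpha$ open, $\overline{X_\alpha}$ Lindelöf, and $\overline{X_\alpha}\subset X_\beta$ whenever $\alpha<\beta$; Type I spaces are always assumed non-Lindelöf. A subset of a Type I space is bounded if it is contained in some $X_\alpha$, otherwise unbounded; a function into a Type I space is (un)bounded if its range is. Club means closed and unbounded. $\mathbb{L}_{\ge 0}$ is the closed long ray $\omega_1\times[0,1)$ with the lexicographic order topology (with $X_\alpha=[0,\alpha)$). A direction in a Type I space $X$ is a club $D\subset X$ such that for every continuous $f:X\to\mathbb{L}_{\ge 0}$, if $f$ is unbounded on $D$ then $f$ is unbounded on every club subset of $D$. *)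

theory Defs
  imports "HOL-Analysis.Analysis"
begin

unbundle cardinal_syntax

typedef omega1 = "Field (cardSuc natLeq)"
proof -
  have "|UNIV :: nat set| <o cardSuc natLeq"
    using cardSuc_greater[OF natLeq_Card_order] card_of_nat ordIso_ordLess_trans by blast
  then have "Field (cardSuc natLeq) \<noteq> {}"
    by (metis Field_natLeq UNIV_not_empty card_of_empty2 card_of_mono2
        cardSuc_ordLeq natLeq_Card_order card_of_empty3)
  then show ?thesis by blast
qed

lemma Well_order_cardSuc_natLeq: "Well_order (cardSuc natLeq)"
  using cardSuc_Card_order[OF natLeq_Card_order] card_order_on_well_order_on by blast

instantiation omega1 :: wellorder
begin

definition less_eq_omega1 :: "omega1 \<Rightarrow> omega1 \<Rightarrow> bool" where
  "\<alpha> \<le> \<beta> \<longleftrightarrow> (Rep_omega1 \<alpha>, Rep_omega1 \<beta>) \<in> cardSuc natLeq"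

definition less_omega1 :: "omega1 \<Rightarrow> omega1 \<Rightarrow> bool" where
  "\<alpha> < \<beta> \<longleftrightarrow> \<alpha> \<le> \<beta> \<and> \<alpha> \<noteq> (\<beta>::omega1)"

instance
proof
  note wo = Well_order_cardSuc_natLeq[unfolded well_order_on_def linear_order_on_def
      partial_order_on_def preorder_on_def]
  fix x y z :: omega1
  have anti: "x = y" if "x \<le> y" "y \<le> x" for x y :: omega1
    using that wo unfolding less_eq_omega1_def antisym_def by (metis Rep_omega1_inject)
  show "x < y \<longleftrightarrow> x \<le> y \<and> \<not> y \<le> x"
    using anti wo Rep_omega1 unfolding less_omega1_def less_eq_omega1_def refl_on_def
    by metis
  show "x \<le> x"
    using wo Rep_omega1 unfolding less_eq_omega1_def refl_on_def by blast
  show "x \<le> y \<Longrightarrow> y \<le> z \<Longrightarrow> x \<le> z"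
    using wo unfolding less_eq_omega1_def trans_def by blast
  show "x \<le> y \<Longrightarrow> y \<le> x \<Longrightarrow> x = y" by (rule anti)
  show "x \<le> y \<or> y \<le> x"
    using wo Rep_omega1 unfolding less_eq_omega1_def total_on_def refl_on_def by metis
next
  fix P :: "omega1 \<Rightarrow> bool" and a
  assume step: "\<And>x. (\<And>y. y < x \<Longrightarrow> P y) \<Longrightarrow> P x"
  have "wf (cardSuc natLeq - Id)"
    using Well_order_cardSuc_natLeq by (simp add: well_order_on_def)
  then have "wf (inv_image (cardSuc natLeq - Id) Rep_omega1)"
    by (rule wf_inv_image)
  then show "P a"
  proof (induction a rule: wf_induct_rule)
    case (less x)
    then show ?case
      using step by (auto simp: inv_image_def less_omega1_def less_eq_omega1_def Rep_omega1_inject)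
  qed
qed

end

instantiation omega1 :: linorder_topology
begin

definition open_omega1 :: "omega1 set \<Rightarrow> bool" where
  "open_omega1 = generate_topology (range (\<lambda>\<alpha>. {..<\<alpha>}) \<union> range (\<lambda>\<alpha>. {\<alpha><..}))"

instance by standard (simp add: open_omega1_def)

end

lemma card_of_omega1: "|UNIV :: omega1 set| =o cardSuc natLeq"
proof -
  have "bij_betw Rep_omega1 UNIV (Field (cardSuc natLeq))"
    using Rep_omega1_inject Rep_omega1 Abs_omega1_inverse
    by (intro bij_betwI[where g = Abs_omega1]) (auto simp: Rep_omega1_inverse)
  then have "|UNIV :: omega1 set| =o |Field (cardSuc natLeq)|"
    using card_of_ordIso by blast
  then show ?thesis
    using card_of_Field_ordIso[OF cardSuc_Card_order[OF natLeq_Card_order]] ordIso_transitive by blast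
qed

lemma uncountable_omega1: "uncountable (UNIV :: omega1 set)"
proof
  assume "countable (UNIV :: omega1 set)"
  then have "|UNIV :: omega1 set| \<le>o |UNIV :: nat set|"
    by (auto simp: countable_def card_of_ordLeq[symmetric])
  then have "cardSuc natLeq \<le>o natLeq"
    using card_of_omega1 card_of_nat ordIso_ordLeq_trans ordIso_symmetric ordLeq_ordIso_trans by blast
  then show False
    using cardSuc_greater[OF natLeq_Card_order] not_ordLess_ordLeq by blast
qed

lemma countable_lessThan_omega1: "countable {..<\<alpha>::omega1}"
proof -
  let ?r = "cardSuc natLeq"
  have "Rep_omega1 ` {..<\<alpha>} \<subseteq> underS ?r (Rep_omega1 \<alpha>)"
    by (auto simp: underS_def less_omega1_def less_eq_omega1_def Rep_omega1_inject)
  moreover have "|underS ?r (Rep_omega1 \<alpha>)| <o ?r"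
    by (rule card_of_underS[OF cardSuc_Card_order[OF natLeq_Card_order] Rep_omega1])
  then have "|underS ?r (Rep_omega1 \<alpha>)| \<le>o natLeq"
    using cardSuc_ordLeq_ordLess[OF natLeq_Card_order card_of_Card_order] by blast
  then have "|underS ?r (Rep_omega1 \<alpha>)| \<le>o |UNIV :: nat set|"
    using card_of_nat ordIso_symmetric ordLeq_ordIso_trans by blast
  then have "countable (underS ?r (Rep_omega1 \<alpha>))"
    by (auto simp: countable_def card_of_ordLeq[symmetric])
  ultimately have "countable (Rep_omega1 ` {..<\<alpha>})"
    using countable_subset by blast
  then show ?thesis
    by (rule countable_image_inj_on) (auto simp: inj_on_def Rep_omega1_inject)
qed

typedef long_ray = "UNIV \<times> {0..<1} :: (omega1 \<times> real) set"
  by (rule exI[of _ "(undefined, 0)"]) simp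

instantiation long_ray :: linorder
begin

definition less_eq_long_ray :: "long_ray \<Rightarrow> long_ray \<Rightarrow> bool" where
  "x \<le> y \<longleftrightarrow> fst (Rep_long_ray x) < fst (Rep_long_ray y) \<or>
     fst (Rep_long_ray x) = fst (Rep_long_ray y) \<and> snd (Rep_long_ray x) \<le> snd (Rep_long_ray y)"

definition less_long_ray :: "long_ray \<Rightarrow> long_ray \<Rightarrow> bool" where
  "x < y \<longleftrightarrow> fst (Rep_long_ray x) < fst (Rep_long_ray y) \<or>
     fst (Rep_long_ray x) = fst (Rep_long_ray y) \<and> snd (Rep_long_ray x) < snd (Rep_long_ray y)"

instance
proof
  fix x y :: long_ray
  show "x \<le> y \<Longrightarrow> y \<le> x \<Longrightarrow> x = y"
    by (auto simp: less_eq_long_ray_def Rep_long_ray_inject[symmetric] prod_eq_iff)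
qed (auto simp: less_eq_long_ray_def less_long_ray_def)

end

instantiation long_ray :: linorder_topology
begin

definition open_long_ray :: "long_ray set \<Rightarrow> bool" where
  "open_long_ray = generate_topology (range (\<lambda>x. {..<x}) \<union> range (\<lambda>x. {x<..}))"

instance by standard (simp add: open_long_ray_def)

end

text \<open>The initial segments \<open>[0,\<alpha>)\<close> of the long ray, with \<open>\<alpha>\<close> identified with \<open>(\<alpha>,0)\<close>.\<close>

definition long_ray_seg :: "omega1 \<Rightarrow> long_ray set" where
  "long_ray_seg \<alpha> = {..<Abs_long_ray (\<alpha>, 0)}"

text \<open>A Type I space is a topology together with its family \<open>X\<^sub>\<alpha>\<close>, as boundedness refers
  to that family. The Hausdorff and non-Lindeloef conventions are part of the definition.\<close>

definition type_I :: "'a topology \<Rightarrow> (omega1 \<Rightarrow> 'a set) \<Rightarrow> bool" where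
  "type_I X Xs \<longleftrightarrow>
     Hausdorff_space X \<and> \<not> Lindelof_space X \<and>
     topspace X = (\<Union>\<alpha>. Xs \<alpha>) \<and>
     (\<forall>\<alpha>. openin X (Xs \<alpha>)) \<and>
     (\<forall>\<alpha>. Lindelof_space (subtopology X (X closure_of Xs \<alpha>))) \<and>
     (\<forall>\<alpha> \<beta>. \<alpha> < \<beta> \<longrightarrow> X closure_of Xs \<alpha> \<subseteq> Xs \<beta>)"

definition bounded_in :: "(omega1 \<Rightarrow> 'a set) \<Rightarrow> 'a set \<Rightarrow> bool" where
  "bounded_in Xs A \<longleftrightarrow> (\<exists>\<alpha>. A \<subseteq> Xs \<alpha>)"

definition club :: "'a topology \<Rightarrow> (omega1 \<Rightarrow> 'a set) \<Rightarrow> 'a set \<Rightarrow> bool" where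
  "club X Xs C \<longleftrightarrow> closedin X C \<and> \<not> bounded_in Xs C"

definition stationary :: "omega1 set \<Rightarrow> bool" where
  "stationary S \<longleftrightarrow> (\<forall>C. club euclidean lessThan C \<longrightarrow> S \<inter> C \<noteq> {})"

definition direction :: "'a topology \<Rightarrow> (omega1 \<Rightarrow> 'a set) \<Rightarrow> 'a set \<Rightarrow> bool" where
  "direction X Xs D \<longleftrightarrow> club X Xs D \<and>
     (\<forall>f :: 'a \<Rightarrow> long_ray. continuous_map X euclidean f \<longrightarrow>
        \<not> bounded_in long_ray_seg (f ` D) \<longrightarrow>
        (\<forall>C. club X Xs C \<and> C \<subseteq> D \<longrightarrow> \<not> bounded_in long_ray_seg (f ` C)))"

definition preimage_seg :: "'a topology \<Rightarrow> ('a \<Rightarrow> omega1) \<Rightarrow> omega1 \<Rightarrow> 'a set" where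
  "preimage_seg X \<pi> \<alpha> = {x \<in> topspace X. \<pi> x < \<alpha>}"

text \<open>That \<open>X\<close> is of Type I for the sets \<open>\<pi>\<^sup>-\<^sup>1[0,\<alpha>)\<close> is a requirement: it does not follow from
  \<open>\<pi>\<close> being a closed map, as fibres may fail to be Lindeloef.\<close>

definition closed_preimage_omega1 :: "'a topology \<Rightarrow> ('a \<Rightarrow> omega1) \<Rightarrow> bool" where
  "closed_preimage_omega1 X \<pi> \<longleftrightarrow>
     type_I X (preimage_seg X \<pi>) \<and>
     continuous_map X euclidean \<pi> \<and> closed_map X euclidean \<pi> \<and>
     (\<forall>\<alpha>. {x \<in> topspace X. \<pi> x = \<alpha>} \<noteq> {})"

end

(* If no club of X is a direction, every club contains two disjoint clubs: f is unbounded on D and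
   bounded on a club C \<subseteq> D, and as f is bounded on every bounded set, the points of D where f
   exceeds its bound on C form a second club.  Iterating gives a binary tree of clubs of height
   omega.  Since pi is closed, a sequence of points whose images converge strictly from below to
   alpha accumulates on the fibre of alpha, so for club many alpha every branch of the tree has a
   point over alpha.  Distinct branches are disjoint, so some fibre over S would have at least
   continuum many points; this rules out both cardinality hypotheses. *)

theory Submission
  imports Defs
begin

section \<open>Countable sets, cofinal sequences and clubs in \<omega>_1\<close>

lemma countable_omega1_bounded:
  fixes A :: "omega1 set"
  assumes "countable A"
  obtains b where "\<And>a. a \<in> A \<Longrightarrow> a < b"
proof -
  have "countable (\<Union>a\<in>A. {..<a} \<union> {a})"
    using assms countable_lessThan_omega1 by auto
  then obtain b where "b \<notin> (\<Union>a\<in>A. {..<a} \<union> {a})"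
    using uncountable_omega1 by (metis UNIV_eq_I)
  then have "a < b" if "a \<in> A" for a
    using that by (auto simp: not_less)
  then show thesis using that by blast
qed

text \<open>As \<open>{..<\<alpha>}\<close> is countable, it can be enumerated as \<open>e\<close>;
  choosing the n-th term in \<open>E n\<close> above \<open>e 0, ..., e n\<close> makes the sequence
  eventually exceed every \<beta> < \<alpha>.\<close>

lemma cofinal_sequence_omega1:
  fixes \<alpha> :: omega1
  assumes "\<beta> < \<alpha>" and dense: "\<And>n \<beta>. \<beta> < \<alpha> \<Longrightarrow> \<exists>\<delta>\<in>E n. \<beta> < \<delta> \<and> \<delta> < \<alpha>"
  obtains a :: "nat \<Rightarrow> omega1"
  where "\<And>n. a n \<in> E n" "\<And>n. a n < \<alpha>" "\<And>\<beta>. \<beta> < \<alpha> \<Longrightarrow> \<exists>N. \<forall>n\<ge>N. \<beta> < a n"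
proof -
  have ne: "{..<\<alpha>} \<noteq> {}" using assms(1) by blast
  define e where "e = from_nat_into {..<\<alpha>}"
  have range_e: "range e = {..<\<alpha>}"
    unfolding e_def using range_from_nat_into[OF ne countable_lessThan_omega1] .
  have "\<exists>\<delta>. \<delta> \<in> E n \<and> \<delta> < \<alpha> \<and> (\<forall>k\<le>n. e k < \<delta>)" for n
  proof -
    have fin: "finite (e ` {..n})" "e ` {..n} \<noteq> {}" by auto
    have "Max (e ` {..n}) < \<alpha>"
      using Max_in[OF fin] range_e by blast
    from dense[OF this, of n] obtain \<delta> where "\<delta> \<in> E n" "Max (e ` {..n}) < \<delta>" "\<delta> < \<alpha>" by blast
    then show ?thesis using Max_less_iff[OF fin] by auto
  qed
  then obtain a where a: "a n \<in> E n" "a n < \<alpha>" "\<forall>k\<le>n. e k < a n" for n by metis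
  have "\<exists>N. \<forall>n\<ge>N. \<beta> < a n" if "\<beta> < \<alpha>" for \<beta>
    using that range_e a(3) by (metis imageE lessThan_iff)
  with a(1,2) show thesis using that by blast
qed

text \<open>Any \<omega>-chain that passes a point of every \<open>E i\<close> at each step has its
  supremum in the set; countability of the index type makes such steps possible. The bound \<gamma>
  keeps out the least ordinal, for which the limit condition is vacuous.\<close>

lemma club_common_limit_points:
  fixes E :: "'i::countable \<Rightarrow> omega1 set"
  assumes unb: "\<And>i \<beta>. \<exists>\<delta>\<in>E i. \<beta> \<le> \<delta>"
  shows "club euclidean lessThan {\<alpha>. \<gamma> < \<alpha> \<and> (\<forall>i. \<forall>\<beta><\<alpha>. \<exists>\<delta>\<in>E i. \<beta> < \<delta> \<and> \<delta> < \<alpha>)}"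
    (is "club _ _ ?L")
proof -
  \<comment> \<open>Successors turn an initial segment with a last element into an open ray.\<close>
  have succ: "\<exists>\<delta>>\<beta>. \<forall>\<alpha>. \<alpha> < \<delta> \<longrightarrow> \<alpha> \<le> \<beta>" for \<beta> :: omega1
  proof -
    obtain b where "\<beta> < b"
      using countable_omega1_bounded[of "{\<beta>}"] by auto
    then show ?thesis
      by (metis (mono_tags) LeastI not_less_Least not_le)
  qed
  have "open (- ?L)"
  proof (subst open_subopen, intro ballI)
    fix \<alpha> assume "\<alpha> \<in> - ?L"
    then consider "\<alpha> \<le> \<gamma>" | i \<beta> where "\<beta> < \<alpha>" "\<And>\<delta>. \<delta> \<in> E i \<Longrightarrow> \<beta> < \<delta> \<Longrightarrow> \<not> \<delta> < \<alpha>"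
      by (fastforce simp: not_less)
    then show "\<exists>T. open T \<and> \<alpha> \<in> T \<and> T \<subseteq> - ?L"
    proof cases
      case 1
      obtain \<sigma> where "\<sigma> > \<gamma>" "\<forall>\<alpha>. \<alpha> < \<sigma> \<longrightarrow> \<alpha> \<le> \<gamma>" using succ by blast
      with 1 show ?thesis by (intro exI[of _ "{..<\<sigma>}"]) (auto simp: not_less)
    next
      case 2
      \<comment> \<open>Every point of the neighbourhood is at most \<alpha>, so below it
        \<open>E i\<close> still has nothing above \<beta>.\<close>
      obtain \<sigma> where "\<sigma> > \<alpha>" "\<forall>\<alpha>'. \<alpha>' < \<sigma> \<longrightarrow> \<alpha>' \<le> \<alpha>" using succ by blast
      with 2 show ?thesis
        by (intro exI[of _ "{\<beta><..<\<sigma>}"]) (auto, metis less_le_trans)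
    qed
  qed
  then have "closedin euclidean ?L" by (simp add: closed_def)
  moreover have "\<not> ?L \<subseteq> {..<b}" for b
  proof -
    have "\<exists>\<delta>. \<beta> < \<delta> \<and> (\<forall>i. \<exists>\<epsilon>\<in>E i. \<beta> < \<epsilon> \<and> \<epsilon> < \<delta>)" for \<beta>
    proof -
      obtain \<sigma> where \<sigma>: "\<beta> < \<sigma>" using succ by blast
      have "\<exists>\<epsilon>. \<epsilon> \<in> E i \<and> \<sigma> \<le> \<epsilon>" for i using unb[where \<beta> = \<sigma> and i = i] by blast
      then obtain h where h: "h i \<in> E i" "\<sigma> \<le> h i" for i by metis
      obtain \<delta> where "\<And>a. a \<in> range h \<Longrightarrow> a < \<delta>"
        using countable_omega1_bounded[of "range h"] by auto
      then show ?thesis using h \<sigma> by (intro exI[of _ \<delta>]) (meson less_le_trans less_trans rangeI)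
    qed
    then obtain nx where nx: "\<beta> < nx \<beta>" "\<exists>\<epsilon>\<in>E i. \<beta> < \<epsilon> \<and> \<epsilon> < nx \<beta>" for i \<beta> by metis
    \<comment> \<open>Starting at \<open>max b \<gamma>\<close> puts the supremum above
      both.\<close>
    define c where "c n = (nx ^^ n) (max b \<gamma>)" for n
    have c_Suc: "c (Suc n) = nx (c n)" for n by (simp add: c_def)
    obtain u where "\<And>a. a \<in> range c \<Longrightarrow> a < u"
      using countable_omega1_bounded[of "range c"] by auto
    then have ub: "\<forall>n. c n < u" by blast
    define \<alpha> where "\<alpha> = (LEAST u. \<forall>n. c n < u)"
    have below: "c n < \<alpha>" for n
      unfolding \<alpha>_def using LeastI[of "\<lambda>u. \<forall>n. c n < u", OF ub] by blast
    have cof: "\<exists>n. \<beta> \<le> c n" if "\<beta> < \<alpha>" for \<beta>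
      using that not_less_Least[of \<beta> "\<lambda>u. \<forall>n. c n < u"] unfolding \<alpha>_def by (auto simp: not_less)
    have "max b \<gamma> < \<alpha>" using below[of 0] by (simp add: c_def)
    moreover have "\<exists>\<delta>\<in>E i. \<beta> < \<delta> \<and> \<delta> < \<alpha>" if \<beta>: "\<beta> < \<alpha>" for i \<beta>
    proof -
      obtain n where "\<beta> \<le> c n" using cof \<beta> by blast
      moreover obtain \<epsilon> where "\<epsilon> \<in> E i" "c n < \<epsilon>" "\<epsilon> < c (Suc n)" using nx(2) c_Suc by metis
      ultimately show ?thesis using below[of "Suc n"] by (meson le_less_trans less_trans)
    qed
    ultimately have "\<alpha> \<in> ?L" "b \<le> \<alpha>" by auto
    then show ?thesis by (meson lessThan_iff not_le subsetD)
  qed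
  ultimately show ?thesis
    unfolding club_def bounded_in_def by blast
qed

section \<open>Bounded sets in the long ray and splitting a club\<close>

lemma long_ray_seg_mono: "\<alpha> \<le> \<beta> \<Longrightarrow> long_ray_seg \<alpha> \<subseteq> long_ray_seg \<beta>"
  unfolding long_ray_seg_def lessThan_subset_iff
  by (auto simp: less_eq_long_ray_def Abs_long_ray_inverse)

lemma long_ray_seg_cover: "\<exists>\<alpha>. y \<in> long_ray_seg \<alpha>"
proof -
  obtain \<alpha> where "fst (Rep_long_ray y) < \<alpha>"
    using countable_omega1_bounded[of "{fst (Rep_long_ray y)}"] by auto
  then show ?thesis
    by (auto simp: long_ray_seg_def less_long_ray_def Abs_long_ray_inverse)
qed

text \<open>The preimages of the segments are an open cover of \<open>K\<close>; the indices of a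
  countable subcover have a common bound.\<close>

lemma Lindelof_imp_bounded_image:
  fixes f :: "'a \<Rightarrow> long_ray"
  assumes "Lindelof_space (subtopology X K)" and "K \<subseteq> topspace X" and f: "continuous_map X euclidean f"
  obtains \<alpha> where "f ` K \<subseteq> long_ray_seg \<alpha>"
proof -
  define U where "U \<alpha> = {x \<in> topspace X. f x \<in> long_ray_seg \<alpha>}" for \<alpha>
  have "openin X (U \<alpha>)" for \<alpha>
    unfolding U_def using f by (intro openin_continuous_map_preimage) (auto simp: long_ray_seg_def)
  moreover have "K \<subseteq> \<Union>(range U)"
    using assms(2) long_ray_seg_cover by (auto simp: U_def)
  ultimately obtain V where V: "countable V" "V \<subseteq> range U" "K \<subseteq> \<Union>V"
    using assms(1,2) unfolding Lindelof_space_subtopology_subset[OF assms(2)]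
    by (metis (no_types, lifting) imageE)
  then obtain A where A: "countable A" "V = U ` A"
    by (metis countable_subset_image)
  obtain b where "\<And>a. a \<in> A \<Longrightarrow> a < b" using countable_omega1_bounded[OF A(1)] by blast
  then have "f ` K \<subseteq> long_ray_seg b"
    using V(3) A(2) long_ray_seg_mono less_imp_le unfolding U_def by blast
  then show thesis using that by blast
qed

lemma split_club:
  assumes "type_I X Xs" and D: "club X Xs D" and "\<not> direction X Xs D"
  shows "\<exists>C F. club X Xs C \<and> club X Xs F \<and> C \<subseteq> D \<and> F \<subseteq> D \<and> C \<inter> F = {}"
proof -
  obtain f :: "'a \<Rightarrow> long_ray" and C where f: "continuous_map X euclidean f"
    and unb: "\<not> bounded_in long_ray_seg (f ` D)"
    and C: "club X Xs C" "C \<subseteq> D" and bd: "bounded_in long_ray_seg (f ` C)"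
    using assms(2,3) unfolding direction_def by blast
  obtain \<gamma> where \<gamma>: "f ` C \<subseteq> long_ray_seg \<gamma>" using bd unfolding bounded_in_def by blast
  \<comment> \<open>The segment is an open ray, so its complement has a closed preimage, disjoint
    from \<open>C\<close>.\<close>
  define F where "F = D \<inter> {x \<in> topspace X. f x \<in> - long_ray_seg \<gamma>}"
  have "closedin X F"
    unfolding F_def using D f
    by (intro closedin_Int closedin_continuous_map_preimage) (auto simp: club_def long_ray_seg_def closed_def)
  moreover have "\<not> bounded_in Xs F"
  proof
    assume "bounded_in Xs F"
    then obtain \<beta> where \<beta>: "F \<subseteq> Xs \<beta>" unfolding bounded_in_def by blast
    \<comment> \<open>The Lindeloef property is available for the closure of
      \<open>Xs \<beta>\<close>. With \<delta> bounding \<open>f\<close> on \<open>F\<close> and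
      \<gamma> bounding it on the rest of \<open>D\<close>, \<open>f\<close> would be bounded on
      \<open>D\<close>.\<close>
    obtain \<delta> where \<delta>: "f ` (X closure_of Xs \<beta>) \<subseteq> long_ray_seg \<delta>"
      using Lindelof_imp_bounded_image[OF _ closure_of_subset_topspace f] assms(1)
      unfolding type_I_def by metis
    have "F \<subseteq> X closure_of Xs \<beta>"
      using \<beta> assms(1) closure_of_subset openin_subset unfolding type_I_def by (metis subset_trans)
    with \<delta> have "f ` F \<subseteq> long_ray_seg \<delta>" by blast
    moreover have "D \<subseteq> topspace X" using D closedin_subset unfolding club_def by blast
    ultimately have "f ` D \<subseteq> long_ray_seg (max \<gamma> \<delta>)"
      using long_ray_seg_mono[of \<gamma> "max \<gamma> \<delta>"] long_ray_seg_mono[of \<delta> "max \<gamma> \<delta>"]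
      unfolding F_def by auto
    with unb show False unfolding bounded_in_def by blast
  qed
  ultimately show ?thesis
    using C \<gamma> unfolding F_def club_def by (intro exI[of _ C] exI[of _ F]) (auto simp: F_def)
qed

section \<open>Points over a limit ordinal\<close>

text \<open>If there were no accumulation point over \<open>\<alpha>\<close>, the range of the sequence would be closed,
  while its image under \<open>\<pi>\<close> is not.\<close>

lemma accumulation_point_over_limit:
  fixes \<pi> :: "'a \<Rightarrow> omega1"
  assumes "t1_space X" and cont: "continuous_map X euclidean \<pi>" and closed: "closed_map X euclidean \<pi>"
    and A: "\<And>n. A n \<in> topspace X" "\<And>n. \<pi> (A n) < \<alpha>"
    and cof: "\<And>\<beta>. \<beta> < \<alpha> \<Longrightarrow> \<exists>N. \<forall>n\<ge>N. \<beta> < \<pi> (A n)"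
  obtains x where "\<pi> x = \<alpha>" "\<And>N::nat. x \<in> X closure_of (A ` {N..})"
proof -
  have "\<exists>x. \<pi> x = \<alpha> \<and> (\<forall>N::nat. x \<in> X closure_of (A ` {N..}))"
  proof (rule ccontr)
    assume none: "\<nexists>x. \<pi> x = \<alpha> \<and> (\<forall>N::nat. x \<in> X closure_of (A ` {N..}))"
    have "X closure_of (range A) \<subseteq> range A"
    proof
      fix y assume y: "y \<in> X closure_of (range A)"
      show "y \<in> range A"
      proof (rule ccontr)
        assume notin: "y \<notin> range A"
        \<comment> \<open>Finite sets are closed in a T1 space, so dropping finitely many terms
          loses no limit point outside the range.\<close>
        have tail: "y \<in> X closure_of (A ` {N..})" for N
        proof -
          have "{..<N} \<union> {N..} = UNIV" by auto
          then have "range A = A ` {..<N} \<union> A ` {N..}" by (metis image_Un)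
          moreover have "closedin X (A ` {..<N})"
            using assms(1) A(1) by (simp add: t1_space_closedin_finite image_subset_iff)
          ultimately show ?thesis
            using y notin by (auto simp: closure_of_Un closure_of_closedin)
        qed
        have clo: "\<pi> y \<in> K" if "closed K" "\<And>n. n \<ge> N \<Longrightarrow> \<pi> (A n) \<in> K" for K and N :: nat
        proof -
          have "closedin X {x \<in> topspace X. \<pi> x \<in> K}"
            using that(1) cont by (intro closedin_continuous_map_preimage) auto
          then have "X closure_of (A ` {N..}) \<subseteq> {x \<in> topspace X. \<pi> x \<in> K}"
            using that(2) A(1) by (intro closure_of_minimal) auto
          then show ?thesis using tail by blast
        qed
        have "\<pi> y \<le> \<alpha>"
          using clo[of "{..\<alpha>}" 0] A(2) by (auto simp: less_imp_le)
        moreover have "\<not> \<pi> y < \<alpha>"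
        proof
          assume "\<pi> y < \<alpha>"
          then obtain N where N: "\<forall>n\<ge>N. \<pi> y < \<pi> (A n)" using cof by blast
          \<comment> \<open>The least \<sigma> above \<open>\<pi> y\<close> is its successor. A tail
            of the images lies in the closed ray from \<sigma> on, and this would force
            \<open>\<pi> y\<close> into it.\<close>
          have "\<pi> y < (LEAST \<sigma>. \<pi> y < \<sigma>)"
            using LeastI[of "\<lambda>\<sigma>. \<pi> y < \<sigma>"] N by blast
          moreover have "\<pi> y \<in> {(LEAST \<sigma>. \<pi> y < \<sigma>)..}"
            using N by (intro clo[of _ N]) (auto intro: Least_le)
          ultimately show False by simp
        qed
        ultimately show False using none tail by (meson order.order_iff_strict)
      qed
    qed
    then have "closedin X (range A)"
      using A(1) closure_of_subset_eq by (metis image_subsetI)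
    then have clo: "closed (\<pi> ` range A)"
      using closed unfolding closed_map_def by simp
    have "\<alpha> \<in> - (\<pi> ` range A)" using A(2) by fastforce
    moreover have "open (- (\<pi> ` range A))" using clo by blast
    ultimately obtain \<beta> where "\<beta> < \<alpha>" "{\<beta><..\<alpha>} \<subseteq> - (\<pi> ` range A)"
      using open_left[of _ \<alpha> "\<pi> (A 0)"] A(2) by metis
    moreover obtain n where "\<beta> < \<pi> (A n)" using cof[OF \<open>\<beta> < \<alpha>\<close>] by blast
    then have "\<pi> (A n) \<in> {\<beta><..\<alpha>}" using A(2)[of n] by simp
    ultimately show False by blast
  qed
  then show thesis using that by blast
qed

text \<open>Choose the n-th point in \<open>D n\<close> with images tending to \<alpha> from below.
  Each \<open>D N\<close> is closed and contains a tail, hence also the accumulation point over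
  \<alpha>.\<close>

lemma decreasing_closed_meet_fibre:
  fixes \<pi> :: "'a \<Rightarrow> omega1"
  assumes "t1_space X" "continuous_map X euclidean \<pi>" "closed_map X euclidean \<pi>"
    and D: "\<And>n. closedin X (D n)" "decseq D"
    and "\<beta> < \<alpha>" and dense: "\<And>n \<beta>. \<beta> < \<alpha> \<Longrightarrow> \<exists>\<delta>\<in>\<pi> ` D n. \<beta> < \<delta> \<and> \<delta> < \<alpha>"
  shows "\<exists>x. x \<in> (\<Inter>n. D n) \<and> \<pi> x = \<alpha>"
proof -
  obtain a where a: "\<And>n. a n \<in> \<pi> ` D n" "\<And>n. a n < \<alpha>" "\<And>\<beta>. \<beta> < \<alpha> \<Longrightarrow> \<exists>N. \<forall>n\<ge>N. \<beta> < a n"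
    using cofinal_sequence_omega1[of \<beta> \<alpha> "\<lambda>n. \<pi> ` D n"] assms(6) dense by metis
  have "\<exists>x. x \<in> D n \<and> \<pi> x = a n" for n using a(1)[of n] by auto
  then obtain A where A: "A n \<in> D n" "\<pi> (A n) = a n" for n by metis
  obtain x where x: "\<pi> x = \<alpha>" "\<And>N::nat. x \<in> X closure_of (A ` {N..})"
    using accumulation_point_over_limit[OF assms(1-3), of A \<alpha>] A a(2,3) D(1) closedin_subset
    by (metis subsetD)
  have "x \<in> D N" for N
  proof -
    have "A ` {N..} \<subseteq> D N" using A(1) D(2) by (auto simp: decseq_def)
    then show ?thesis using x(2)[of N] closure_of_minimal[OF _ D(1)] by blast
  qed
  with x(1) show ?thesis by blast
qed

section \<open>The binary tree of clubs and its branches\<close>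

lemma no_direction_imp_continuum_fibre:
  fixes X :: "'a topology" and \<pi> :: "'a \<Rightarrow> omega1"
  assumes X: "closed_preimage_omega1 X \<pi>" and S: "stationary S"
    and no_dir: "\<nexists>D. direction X (preimage_seg X \<pi>) D"
  obtains \<alpha> and g :: "(nat \<Rightarrow> bool) \<Rightarrow> 'a"
  where "\<alpha> \<in> S" "inj g" "range g \<subseteq> {x \<in> topspace X. \<pi> x = \<alpha>}"
proof -
  let ?club = "club X (preimage_seg X \<pi>)"
  have tI: "type_I X (preimage_seg X \<pi>)" and cont: "continuous_map X euclidean \<pi>"
    and closed: "closed_map X euclidean \<pi>" and surj: "\<And>\<alpha>. {x \<in> topspace X. \<pi> x = \<alpha>} \<noteq> {}"
    using X unfolding closed_preimage_omega1_def by auto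
  have t1: "t1_space X"
    using tI Hausdorff_imp_t1_space unfolding type_I_def by blast
  have "\<not> topspace X \<subseteq> preimage_seg X \<pi> \<alpha>" for \<alpha>
    using surj[of \<alpha>] by (auto simp: preimage_seg_def)
  then have top: "?club (topspace X)"
    unfolding club_def bounded_in_def by simp
  have "\<exists>h. \<forall>b. ?club D \<longrightarrow> ?club (h b) \<and> h b \<subseteq> D \<and> h True \<inter> h False = {}" for D
  proof (cases "?club D")
    case True
    then obtain C F where "?club C" "?club F" "C \<subseteq> D" "F \<subseteq> D" "C \<inter> F = {}"
      using split_club[OF tI True] no_dir by blast
    then show ?thesis by (intro exI[of _ "\<lambda>b. if b then C else F"]) auto
  qed auto
  then obtain sp where sp: "\<And>D b. ?club D \<Longrightarrow> ?club (sp D b)" "\<And>D b. ?club D \<Longrightarrow> sp D b \<subseteq> D"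
    "\<And>D. ?club D \<Longrightarrow> sp D True \<inter> sp D False = {}" by metis
  \<comment> \<open>The node reached by the bits \<open>s\<close>; \<open>foldr\<close> applies the
    last list element first, so the head is the most recent choice.\<close>
  define T where "T s = foldr (\<lambda>b D. sp D b) s (topspace X)" for s
  have T_Cons: "T (b # s) = sp (T s) b" for b s by (simp add: T_def)
  have clubT: "?club (T s)" for s
    by (induction s) (auto simp: T_Cons sp(1), simp add: T_def top)
  have unbT: "\<exists>\<delta>\<in>\<pi> ` T s. \<beta> \<le> \<delta>" for s \<beta>
    using clubT[of s] closedin_subset[of X "T s"]
    unfolding club_def bounded_in_def preimage_seg_def by (fastforce simp: not_less)
  \<comment> \<open>Finite bit lists are countably many, so a single club serves all nodes, and
    \<open>S\<close> meets it. The arbitrary ordinal \<open>undefined\<close> witnesses that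
    \<alpha> is not least.\<close>
  obtain \<alpha> where "\<alpha> \<in> S" and "undefined < \<alpha>"
    and lim: "\<And>s \<beta>. \<beta> < \<alpha> \<Longrightarrow> \<exists>\<delta>\<in>\<pi> ` T s. \<beta> < \<delta> \<and> \<delta> < \<alpha>"
    using S club_common_limit_points[of "\<lambda>s. \<pi> ` T s" undefined, OF unbT]
    unfolding stationary_def by blast
  \<comment> \<open>The node after the first \<open>n\<close> bits of the branch \<open>x\<close>;
    \<open>rev\<close> puts the latest bit at the head.\<close>
  define B where "B x n = T (rev (map x [0..<n]))" for x :: "nat \<Rightarrow> bool" and n
  have B_Suc: "B x (Suc n) = sp (B x n) (x n)" for x n by (simp add: B_def T_Cons)
  have clubB: "?club (B x n)" for x n by (simp add: B_def clubT)
  have "\<exists>p. p \<in> (\<Inter>n. B x n) \<and> \<pi> p = \<alpha>" for x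
  proof (rule decreasing_closed_meet_fibre[OF t1 cont closed])
    show "closedin X (B x n)" for n using clubB unfolding club_def by blast
    show "decseq (B x)" by (intro decseq_SucI) (simp add: B_Suc sp(2) clubB)
    show "undefined < \<alpha>" by fact
    show "\<exists>\<delta>\<in>\<pi> ` B x n. \<beta> < \<delta> \<and> \<delta> < \<alpha>" if "\<beta> < \<alpha>" for n \<beta>
      unfolding B_def using lim that .
  qed
  then obtain g where g: "\<And>x n. g x \<in> B x n" "\<And>x. \<pi> (g x) = \<alpha>"
    by (metis INT_iff UNIV_I)
  have "inj g"
  proof (rule injI, rule ccontr)
    fix x y assume eq: "g x = g y" and "x \<noteq> y"
    then have ex: "\<exists>n. x n \<noteq> y n" by blast
    \<comment> \<open>Up to the first difference the branches share a node; there they enter its two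
      disjoint halves.\<close>
    define n where "n = (LEAST n. x n \<noteq> y n)"
    have n: "x n \<noteq> y n" "\<And>m. m < n \<Longrightarrow> x m = y m"
      unfolding n_def using LeastI_ex[OF ex] not_less_Least by blast+
    have "B x n = B y n"
      unfolding B_def using n(2) by (intro arg_cong[where f = "\<lambda>s. T (rev s)"]) simp
    then have "g x \<in> sp (B x n) (x n) \<inter> sp (B x n) (y n)"
      using g(1)[of x "Suc n"] g(1)[of y "Suc n"] eq by (simp add: B_Suc)
    then show False using n(1) sp(3)[OF clubB[of x n]] by (cases "x n"; cases "y n") auto
  qed
  moreover have "range g \<subseteq> {x \<in> topspace X. \<pi> x = \<alpha>}"
    using g clubB closedin_subset unfolding club_def by blast
  ultimately show thesis using that \<open>\<alpha> \<in> S\<close> by blast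
qed

theorem theorem3p14:
  fixes X :: "'a topology" and \<pi> :: "'a \<Rightarrow> omega1" and S :: "omega1 set"
  assumes "closed_preimage_omega1 X \<pi>" and "stationary S"
  shows "((\<forall>\<alpha>\<in>S. finite {x \<in> topspace X. \<pi> x = \<alpha>}) \<longrightarrow>
            (\<exists>D. direction X (preimage_seg X \<pi>) D)) \<and>
         (\<forall>\<kappa> :: 'b rel.
            Card_order \<kappa> \<and> regularCard \<kappa> \<and> cardSuc natLeq <o \<kappa> \<and> \<kappa> \<le>o ctwo ^c natLeq \<and>
            (\<forall>\<alpha>\<in>S. |{x \<in> topspace X. \<pi> x = \<alpha>}| <o \<kappa>) \<longrightarrow>
            (\<exists>D. direction X (preimage_seg X \<pi>) D))"
proof (cases "\<exists>D. direction X (preimage_seg X \<pi>) D")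
  case False
  then obtain \<alpha> and g :: "(nat \<Rightarrow> bool) \<Rightarrow> 'a"
    where \<alpha>: "\<alpha> \<in> S" and g: "inj g" "range g \<subseteq> {x \<in> topspace X. \<pi> x = \<alpha>}"
    using no_direction_imp_continuum_fibre[OF assms] by metis
  let ?F = "{x \<in> topspace X. \<pi> x = \<alpha>}"
  have "infinite (UNIV :: (nat \<Rightarrow> bool) set)"
    using finite_fun_UNIVD1[where 'a = nat and 'b = bool] by auto
  then have inf: "infinite ?F"
    using g by (metis finite_imageD finite_subset)
  have "|UNIV :: (nat \<Rightarrow> bool) set| \<le>o |?F|"
    using g card_of_ordLeq by blast
  \<comment> \<open>An equality of relations: \<open>Func\<close> between full types is the whole
    function type.\<close>
  moreover have "ctwo ^c natLeq = |UNIV :: (nat \<Rightarrow> bool) set|"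
    by (simp add: cexp_def ctwo_def Field_natLeq Field_card_of Func_def)
  ultimately have le: "ctwo ^c natLeq \<le>o |?F|" by simp
  \<comment> \<open>The fibre has at least continuum many points, hence at least \<kappa>.\<close>
  have "\<not> |?F| <o \<kappa>" if "\<kappa> \<le>o ctwo ^c natLeq" for \<kappa> :: "'b rel"
    using that le by (meson not_ordLess_ordLeq ordLeq_transitive)
  then show ?thesis using inf \<alpha> by blast
qed simp

end
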